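(* Let $\mathcal H_1,\mathcal H_2$ be Hilbert spaces and $U\subseteq\mathcal H_1\oplus\mathcal H_2$ a subspace. Then $U$ is the graph of a unitary operator $L$ (from $\mathcal H_1$ to $\mathcal H_2$) if and only if $U=U^{\perp_\omega}$, where $\omega$ is the standard unitary form on $\mathcal H_1\oplus\mathcal H_2$.
   Context: Hilbert spaces are over $\mathbb K\in\{\mathbb R,\mathbb C\}$, and a subspace is a linear subspace, not assumed closed. The standard unitary form on $\mathcal H_1\oplus\mathcal H_2$ is the sesquilinear form $\omega((x,y),(u,v))=(x\mid u)_{\mathcal H_1}-(y\mid v)_{\mathcal H_2}$. For $U\subseteq\mathcal H_1\oplus\mathcal H_2$, $U^{\perp_\omega}=\{z\in\mathcal H_1\oplus\mathcal H_2 : \omega(z,w)=0 \text{ for all } w\in U\}$. The graph of $L$ is $\{(x,Lx): x\in\mathcal H_1\}$. *)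

theory Defs
  imports "HOL-Analysis.Analysis"
begin

(* The scalar fields: to_complex identifies the type with exactly \<real> or the whole of the
   complex numbers, so that one statement covers both cases. *)
class real_or_complex = field +
  fixes to_complex :: "'a \<Rightarrow> complex"
  assumes to_complex_one: "to_complex 1 = 1"
    and to_complex_add: "to_complex (a + b) = to_complex a + to_complex b"
    and to_complex_mult: "to_complex (a * b) = to_complex a * to_complex b"
    and inj_to_complex: "inj to_complex"
    and range_to_complex: "range to_complex = \<real> \<or> range to_complex = UNIV"

instantiation real :: real_or_complex
begin

definition to_complex_real :: "real \<Rightarrow> complex" where
  "to_complex_real = complex_of_real"

instance
  by standard (auto simp: to_complex_real_def Reals_def inj_def)

end

instantiation complex :: real_or_complex
begin

definition to_complex_complex :: "complex \<Rightarrow> complex" where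
  "to_complex_complex = (\<lambda>z. z)"

instance
  by standard (auto simp: to_complex_complex_def inj_def)

end

definition ip_norm :: "('a \<Rightarrow> 'a \<Rightarrow> 'k::real_or_complex) \<Rightarrow> 'a \<Rightarrow> real" where
  "ip_norm ip x = sqrt (Re (to_complex (ip x x)))"

(* Inner products are linear in the first argument; for real scalars ip_conj is symmetry. *)
locale inner_product_space = vector_space scale
  for scale :: "'k::real_or_complex \<Rightarrow> 'a::ab_group_add \<Rightarrow> 'a" +
  fixes ip :: "'a \<Rightarrow> 'a \<Rightarrow> 'k"
  assumes ip_add_left: "ip (x + y) z = ip x z + ip y z"
    and ip_scale_left: "ip (scale c x) y = c * ip x y"
    and ip_conj: "to_complex (ip y x) = cnj (to_complex (ip x y))"
    and ip_pos: "x \<noteq> 0 \<Longrightarrow> 0 < Re (to_complex (ip x x))"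

locale hilbert_space = inner_product_space scale ip
  for scale :: "'k::real_or_complex \<Rightarrow> 'a::ab_group_add \<Rightarrow> 'a" and ip +
  assumes complete: "Metric_space.mcomplete UNIV (\<lambda>x y. ip_norm ip (x - y))"

lemma real_hilbert_space:
  "hilbert_space scaleR (inner :: 'a::{real_inner, complete_space} \<Rightarrow> 'a \<Rightarrow> real)"
proof -
  have norm_eq: "ip_norm inner (z::'a) = norm z" for z
    by (simp add: ip_norm_def to_complex_real_def norm_eq_sqrt_inner)
  have "Metric_space.mcomplete UNIV (dist :: 'a \<Rightarrow> 'a \<Rightarrow> real)"
    by (simp add: complete_UNIV)
  then show ?thesis
    by unfold_locales
      (auto simp: norm_eq to_complex_real_def inner_commute
        inner_add_left algebra_simps simp flip: dist_norm)
qed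

lemma complex_hilbert_space: "hilbert_space (*) (\<lambda>x y :: complex. x * cnj y)"
proof -
  have norm_eq: "ip_norm (\<lambda>x y :: complex. x * cnj y) z = norm z" for z
    by (simp add: ip_norm_def to_complex_complex_def complex_mult_cnj cmod_def)
  have "Metric_space.mcomplete UNIV (dist :: complex \<Rightarrow> complex \<Rightarrow> real)"
    by (simp add: complete_UNIV)
  moreover have "0 < Re (x * cnj x)" if "x \<noteq> 0" for x :: complex
    using that by (simp add: complex_mult_cnj sum_power2_gt_zero_iff complex_eq_iff)
  ultimately show ?thesis
    by unfold_locales
      (auto simp: norm_eq to_complex_complex_def algebra_simps simp flip: dist_norm)
qed

definition unitary_operator ::
  "('k::real_or_complex \<Rightarrow> 'a::ab_group_add \<Rightarrow> 'a) \<Rightarrow> ('a \<Rightarrow> 'a \<Rightarrow> 'k) \<Rightarrow>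
   ('k \<Rightarrow> 'b::ab_group_add \<Rightarrow> 'b) \<Rightarrow> ('b \<Rightarrow> 'b \<Rightarrow> 'k) \<Rightarrow> ('a \<Rightarrow> 'b) \<Rightarrow> bool" where
  "unitary_operator scale1 ip1 scale2 ip2 L \<longleftrightarrow>
     Vector_Spaces.linear scale1 scale2 L \<and> surj L \<and> (\<forall>x y. ip2 (L x) (L y) = ip1 x y)"

definition op_graph :: "('a \<Rightarrow> 'b) \<Rightarrow> ('a \<times> 'b) set" where
  "op_graph L = {(x, L x) | x. x \<in> UNIV}"

definition std_unitary_form ::
  "('a \<Rightarrow> 'a \<Rightarrow> 'k::real_or_complex) \<Rightarrow> ('b \<Rightarrow> 'b \<Rightarrow> 'k) \<Rightarrow> 'a \<times> 'b \<Rightarrow> 'a \<times> 'b \<Rightarrow> 'k" where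
  "std_unitary_form ip1 ip2 z w = ip1 (fst z) (fst w) - ip2 (snd z) (snd w)"

definition form_complement :: "('c \<Rightarrow> 'c \<Rightarrow> 'k::zero) \<Rightarrow> 'c set \<Rightarrow> 'c set" where
  "form_complement \<omega> U = {z. \<forall>w\<in>U. \<omega> z w = 0}"

end

theory Submission
  imports Defs
begin

text \<open>
  Write \<open>\<omega>\<close> for the standard unitary form.

  If \<open>U\<close> is the graph of a unitary \<open>L\<close>, then \<open>\<omega>\<close> vanishes on \<open>U\<close> because \<open>L\<close> is isometric. A
  vector \<open>(x, y)\<close> that is \<open>\<omega>\<close>-orthogonal to \<open>U\<close> satisfies \<open>(L x - y | L u) = 0\<close> for all \<open>u\<close>, and
  as \<open>L\<close> is onto, this forces \<open>y = L x\<close>.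

  Conversely, let \<open>U\<close> be its own complement. Since \<open>\<omega>\<close> vanishes on \<open>U\<close>, related vectors have the
  same norm, so \<open>U\<close> is the graph of an isometry on its domain, the first projection \<open>D\<close> of \<open>U\<close>.
  The real content is that \<open>D\<close> is the whole space (lemma \<open>domain_of_self_complement\<close>). The subspace
  \<open>D\<close> has trivial orthogonal complement, since for \<open>z\<close> orthogonal to \<open>D\<close> the vector \<open>(z, 0)\<close> lies in
  the complement of \<open>U\<close>, hence in \<open>U\<close>, and so \<open>z = 0\<close>. Moreover \<open>U\<close>, being a complement, is closed,
  and as it is the graph of an isometry into a complete space, \<open>D\<close> is closed too. The projection
  argument then applies: a sequence in \<open>D\<close> minimising the distance to a given \<open>x\<close> is Cauchy by the
  parallelogram law, its limit \<open>d\<close> lies in \<open>D\<close>, and \<open>x - d\<close> is orthogonal to \<open>D\<close>, so \<open>x = d\<close>.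
  Exchanging the two spaces only changes the sign of \<open>\<omega>\<close>, so the second projection of \<open>U\<close> is
  everything as well, and the isometry is onto.
\<close>

section \<open>Scalars\<close>

lemma to_complex_0 [simp]: "to_complex 0 = 0"
  using to_complex_add[of 0 0] by simp

lemma to_complex_minus: "to_complex (- a) = - to_complex a"
  using to_complex_add[of a "- a"] by (simp add: add_eq_0_iff)

lemma to_complex_diff: "to_complex (a - b) = to_complex a - to_complex b"
  using to_complex_add[of a "- b"] by (simp add: to_complex_minus)

lemma to_complex_eq_iff: "to_complex a = to_complex b \<longleftrightarrow> a = b"
  using inj_to_complex by (auto dest: injD)

lemma real_scalar_exists: "\<exists>a. to_complex a = of_real t"
proof -
  have "complex_of_real t \<in> range (to_complex :: 'a \<Rightarrow> complex)"
    using range_to_complex by auto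
  then show ?thesis by (metis imageE)
qed

section \<open>Inner products over either field\<close>

context inner_product_space
begin

text \<open>
  The inner product read as a complex number: conjugating and taking real parts makes no sense in
  the abstract scalar field.
\<close>
definition cip :: "'a \<Rightarrow> 'a \<Rightarrow> complex" where
  "cip x y = to_complex (ip x y)"

definition sqnorm :: "'a \<Rightarrow> real" where
  "sqnorm x = Re (cip x x)"

lemma cip_cnj: "cip y x = cnj (cip x y)"
  unfolding cip_def by (rule ip_conj)

lemma cip_add_left: "cip (x + y) z = cip x z + cip y z"
  by (simp add: cip_def ip_add_left to_complex_add)

lemma cip_scale_left: "cip (scale c x) y = to_complex c * cip x y"
  by (simp add: cip_def ip_scale_left to_complex_mult)

lemma cip_diff_left: "cip (x - y) z = cip x z - cip y z"
  using cip_add_left[of "x - y" y z] by simp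

lemma cip_zero_left [simp]: "cip 0 z = 0"
  using cip_diff_left[of 0 0 z] by simp

lemma cip_add_right: "cip z (x + y) = cip z x + cip z y"
  by (metis cip_cnj cip_add_left complex_cnj_add)

lemma cip_diff_right: "cip z (x - y) = cip z x - cip z y"
  by (metis cip_cnj cip_diff_left complex_cnj_diff)

lemma cip_scale_right: "cip z (scale c x) = cnj (to_complex c) * cip z x"
  by (metis cip_cnj cip_scale_left complex_cnj_mult)

lemma cip_self: "cip x x = of_real (sqnorm x)"
proof -
  have "Im (cip x x) = - Im (cip x x)"
    using arg_cong[OF cip_cnj[of x x], of Im] by simp
  then show ?thesis by (simp add: complex_eq_iff sqnorm_def)
qed

lemma sqnorm_zero [simp]: "sqnorm 0 = 0"
  by (simp add: sqnorm_def)

lemma sqnorm_pos: "x \<noteq> 0 \<Longrightarrow> 0 < sqnorm x"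
  using ip_pos by (simp add: sqnorm_def cip_def)

lemma sqnorm_nonneg [simp]: "0 \<le> sqnorm x"
  using sqnorm_pos[of x] by (cases "x = 0") auto

lemma sqnorm_eq_0_iff: "sqnorm x = 0 \<longleftrightarrow> x = 0"
  using sqnorm_pos[of x] by (cases "x = 0") auto

lemma ip_norm_eq: "ip_norm ip x = sqrt (sqnorm x)"
  by (simp add: ip_norm_def sqnorm_def cip_def)

lemma ip_norm_nonneg [simp]: "0 \<le> ip_norm ip x"
  by (simp add: ip_norm_eq)

lemma ip_norm_power2: "(ip_norm ip x)\<^sup>2 = sqnorm x"
  by (simp add: ip_norm_eq)

lemma ip_norm_eq_0_iff: "ip_norm ip x = 0 \<longleftrightarrow> x = 0"
  by (simp add: ip_norm_eq sqnorm_eq_0_iff)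

lemma sqnorm_scale: "sqnorm (scale c x) = (cmod (to_complex c))\<^sup>2 * sqnorm x"
proof -
  have "complex_of_real (sqnorm (scale c x)) =
    (to_complex c * cnj (to_complex c)) * of_real (sqnorm x)"
    by (simp add: cip_self[symmetric] cip_scale_left cip_scale_right)
  also have "\<dots> = of_real ((cmod (to_complex c))\<^sup>2 * sqnorm x)"
    by (simp add: complex_mult_cnj cmod_power2)
  finally show ?thesis using of_real_eq_iff by blast
qed

lemma sqnorm_add: "sqnorm (x + y) = sqnorm x + sqnorm y + 2 * Re (cip x y)"
  using cip_cnj[of y x] by (simp add: sqnorm_def cip_add_left cip_add_right)

lemma sqnorm_diff: "sqnorm (x - y) = sqnorm x + sqnorm y - 2 * Re (cip x y)"
  using cip_cnj[of y x] by (simp add: sqnorm_def cip_diff_left cip_diff_right)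

lemma ip_norm_minus_commute: "ip_norm ip (x - y) = ip_norm ip (y - x)"
  by (simp add: ip_norm_eq sqnorm_diff cip_cnj[of y x])

text \<open>
  Subtracting from \<open>z\<close> its component along \<open>w\<close>. Both the Cauchy-Schwarz inequality and the
  orthogonality of a minimal vector are read off from this single computation.
\<close>
lemma sqnorm_remove_component:
  assumes "w \<noteq> 0"
  shows "\<exists>c. sqnorm (z - scale c w) = sqnorm z - (cmod (cip z w))\<^sup>2 / sqnorm w"
proof -
  obtain a :: 'k where a: "to_complex a = of_real (1 / sqnorm w)"
    using real_scalar_exists by blast
  define c where "c = a * ip z w"
  have c: "to_complex c = cip z w / of_real (sqnorm w)"
    by (simp add: c_def to_complex_mult a cip_def)
  have "cip z (scale c w) = of_real ((cmod (cip z w))\<^sup>2 / sqnorm w)"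
    unfolding cip_scale_right c by (simp add: mult.commute flip: complex_norm_square)
  moreover have "sqnorm (scale c w) = (cmod (cip z w))\<^sup>2 / sqnorm w"
    using sqnorm_pos[OF assms]
    by (simp add: sqnorm_scale c norm_divide power2_eq_square)
  ultimately show ?thesis
    by (intro exI[of _ c]) (simp add: sqnorm_diff)
qed

lemma Cauchy_Schwarz: "cmod (cip x y) \<le> ip_norm ip x * ip_norm ip y"
proof (cases "y = 0")
  case True
  then show ?thesis using cip_cnj[of y x] by simp
next
  case False
  obtain c where "sqnorm (x - scale c y) = sqnorm x - (cmod (cip x y))\<^sup>2 / sqnorm y"
    using sqnorm_remove_component[OF False] by blast
  then have "(cmod (cip x y))\<^sup>2 / sqnorm y \<le> sqnorm x"
    using sqnorm_nonneg[of "x - scale c y"] by simp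
  then have "(cmod (cip x y))\<^sup>2 \<le> (ip_norm ip x * ip_norm ip y)\<^sup>2"
    using sqnorm_pos[OF False] by (simp add: pos_divide_le_eq power_mult_distrib ip_norm_power2)
  then show ?thesis by (rule power2_le_imp_le) simp
qed

lemma ip_norm_triangle: "ip_norm ip (x + y) \<le> ip_norm ip x + ip_norm ip y"
proof (rule power2_le_imp_le)
  have "Re (cip x y) \<le> ip_norm ip x * ip_norm ip y"
    using Cauchy_Schwarz[of x y] complex_Re_le_cmod[of "cip x y"] by linarith
  then show "(ip_norm ip (x + y))\<^sup>2 \<le> (ip_norm ip x + ip_norm ip y)\<^sup>2"
    by (simp add: power2_sum ip_norm_power2 sqnorm_add)
qed simp

lemma Metric_space_ip_norm: "Metric_space UNIV (\<lambda>x y. ip_norm ip (x - y))"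
proof
  fix x y z :: 'a
  show "ip_norm ip (x - y) = ip_norm ip (y - x)"
    by (rule ip_norm_minus_commute)
  show "ip_norm ip (x - z) \<le> ip_norm ip (x - y) + ip_norm ip (y - z)"
    using ip_norm_triangle[of "x - y" "y - z"] by simp
qed (simp_all add: ip_norm_eq_0_iff)

lemma cip_tendsto_left:
  assumes "(\<lambda>n. ip_norm ip (s n - l)) \<longlonglongrightarrow> 0"
  shows "(\<lambda>n. cip (s n) v) \<longlonglongrightarrow> cip l v"
proof (rule LIM_zero_cancel, rule Lim_null_comparison)
  show "\<forall>\<^sub>F n in sequentially. cmod (cip (s n) v - cip l v) \<le> ip_norm ip (s n - l) * ip_norm ip v"
    using Cauchy_Schwarz[of "s _ - l" v] by (simp add: cip_diff_left)
  show "(\<lambda>n. ip_norm ip (s n - l) * ip_norm ip v) \<longlonglongrightarrow> 0"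
    using assms by (rule tendsto_mult_left_zero)
qed

section \<open>Minimising the distance to a subspace\<close>

lemma orthogonal_if_minimal:
  assumes "\<And>c. sqnorm z \<le> sqnorm (z - scale c w)"
  shows "cip z w = 0"
proof (cases "w = 0")
  case True
  then show ?thesis using cip_cnj[of w z] by simp
next
  case False
  obtain c where "sqnorm (z - scale c w) = sqnorm z - (cmod (cip z w))\<^sup>2 / sqnorm w"
    using sqnorm_remove_component[OF False] by blast
  then have "(cmod (cip z w))\<^sup>2 / sqnorm w \<le> 0"
    using assms[of c] by simp
  then show ?thesis
    using sqnorm_pos[OF False] by (simp add: divide_le_0_iff)
qed

text \<open>
  The parallelogram law for \<open>x - v\<close> and \<open>x - w\<close>; the midpoint of \<open>v\<close> and \<open>w\<close> is again in \<open>D\<close> and so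
  no closer to \<open>x\<close> than the bound allows. Two points of \<open>D\<close> that nearly attain the bound are
  therefore near to each other.
\<close>
lemma sqnorm_diff_le_of_near_minimal:
  assumes D: "subspace D" "v \<in> D" "w \<in> D"
    and lower: "\<And>u. u \<in> D \<Longrightarrow> \<delta> \<le> sqnorm (x - u)"
  shows "sqnorm (v - w) \<le> 2 * (sqnorm (x - v) - \<delta>) + 2 * (sqnorm (x - w) - \<delta>)"
proof -
  obtain h :: 'k where h: "to_complex h = of_real (1/2)"
    using real_scalar_exists by blast
  have hh: "h + h = 1"
    by (rule to_complex_eq_iff[THEN iffD1]) (simp only: to_complex_add to_complex_one h, simp)
  have half: "scale h z + scale h z = z" for z
    by (metis hh scale_left_distrib scale_one)
  define m where "m = scale h (v + w)"
  have "m \<in> D"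
    unfolding m_def using D by (intro subspace_scale subspace_add)
  have "scale h ((x - v) + (x - w)) = scale h (x + x) - m"
    unfolding m_def by (simp only: scale_right_diff_distrib[symmetric]) (simp add: algebra_simps)
  then have mid: "scale h ((x - v) + (x - w)) = x - m"
    using half[of x] by (simp add: scale_right_distrib)
  have "sqnorm ((x - v) + (x - w)) = 4 * sqnorm (x - m)"
    unfolding mid[symmetric] sqnorm_scale h by (simp add: power2_eq_square)
  then have "4 * \<delta> \<le> sqnorm ((x - v) + (x - w))"
    using lower[OF \<open>m \<in> D\<close>] by simp
  moreover have "v - w = (x - w) - (x - v)"
    by simp
  then have "sqnorm (v - w) = sqnorm ((x - w) - (x - v))"
    by (rule arg_cong)
  then have "sqnorm (v - w) = sqnorm (x - w) + sqnorm (x - v) - 2 * Re (cip (x - v) (x - w))"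
    unfolding sqnorm_diff[of "x - w" "x - v"] by (simp add: cip_cnj[of "x - w" "x - v"])
  moreover have
    "4 * e \<le> a + b + 2 * r \<Longrightarrow> c = b + a - 2 * r \<Longrightarrow> c \<le> 2 * (a - e) + 2 * (b - e)"
    for a b c e r :: real by simp
  ultimately show ?thesis
    unfolding sqnorm_add[of "x - v" "x - w"] by blast
qed

lemma minimising_Cauchy_sequence:
  assumes "subspace D"
  obtains s \<delta> where "\<And>n::nat. s n \<in> D" "(\<lambda>n. sqnorm (x - s n)) \<longlonglongrightarrow> \<delta>"
    "\<And>u. u \<in> D \<Longrightarrow> \<delta> \<le> sqnorm (x - u)"
    "\<And>e. 0 < e \<Longrightarrow> \<exists>N. \<forall>m\<ge>N. \<forall>n\<ge>N. ip_norm ip (s m - s n) < e"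
proof -
  define \<delta> where "\<delta> = (INF u\<in>D. sqnorm (x - u))"
  have bdd: "bdd_below ((\<lambda>u. sqnorm (x - u)) ` D)"
    by (rule bdd_belowI2[of _ 0]) simp
  have lower: "\<delta> \<le> sqnorm (x - u)" if "u \<in> D" for u
    unfolding \<delta>_def using bdd that by (rule cINF_lower)
  have "\<exists>u\<in>D. sqnorm (x - u) < \<delta> + 1 / real (Suc n)" for n
  proof (rule ccontr)
    assume "\<not> ?thesis"
    then have "\<delta> + 1 / real (Suc n) \<le> \<delta>"
      unfolding \<delta>_def using subspace_0[OF assms] by (intro cINF_greatest) auto
    then show False by simp
  qed
  then obtain s where s: "\<And>n. s n \<in> D" "\<And>n. sqnorm (x - s n) < \<delta> + 1 / real (Suc n)"
    by metis
  have lim: "(\<lambda>n. sqnorm (x - s n)) \<longlonglongrightarrow> \<delta>"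
  proof (rule tendsto_sandwich[of "\<lambda>_. \<delta>" _ _ "\<lambda>n. \<delta> + 1 / real (Suc n)"])
    show "(\<lambda>n. \<delta> + 1 / real (Suc n)) \<longlonglongrightarrow> \<delta>"
      using tendsto_add[OF tendsto_const[of \<delta>] LIMSEQ_inverse_real_of_nat]
      by (simp add: inverse_eq_divide)
    show "\<forall>\<^sub>F n in sequentially. \<delta> \<le> sqnorm (x - s n)"
      using lower[OF s(1)] by simp
    show "\<forall>\<^sub>F n in sequentially. sqnorm (x - s n) \<le> \<delta> + 1 / real (Suc n)"
      using s(2) by (intro always_eventually allI less_imp_le)
  qed simp
  have "\<exists>N. \<forall>m\<ge>N. \<forall>n\<ge>N. ip_norm ip (s m - s n) < e" if "0 < e" for e
  proof -
    have "0 < e\<^sup>2 / 4" using that by simp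
    then have "\<forall>\<^sub>F n in sequentially. sqnorm (x - s n) < \<delta> + e\<^sup>2 / 4"
      by (intro order_tendstoD(2)[OF lim]) simp
    then obtain N where N: "\<And>n. n \<ge> N \<Longrightarrow> sqnorm (x - s n) < \<delta> + e\<^sup>2 / 4"
      by (auto simp: eventually_sequentially)
    have "ip_norm ip (s m - s n) < e" if "m \<ge> N" "n \<ge> N" for m n
    proof -
      have "sqnorm (s m - s n) \<le> 2 * (sqnorm (x - s m) - \<delta>) + 2 * (sqnorm (x - s n) - \<delta>)"
        using assms s(1) s(1) lower by (rule sqnorm_diff_le_of_near_minimal)
      also have "\<dots> < e\<^sup>2"
        using N[OF that(1)] N[OF that(2)] by simp
      finally have "(ip_norm ip (s m - s n))\<^sup>2 < e\<^sup>2"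
        by (simp add: ip_norm_power2)
      then show ?thesis
        by (rule power2_less_imp_less) (rule less_imp_le[OF \<open>0 < e\<close>])
    qed
    then show ?thesis by blast
  qed
  with s(1) lim lower that show thesis by blast
qed

end

lemma (in hilbert_space) Cauchy_sequence_converges:
  assumes "\<And>e. 0 < e \<Longrightarrow> \<exists>N. \<forall>m\<ge>N. \<forall>n\<ge>N. ip_norm ip (s m - s n) < e"
  obtains l where "(\<lambda>n. ip_norm ip (s n - l)) \<longlonglongrightarrow> 0"
proof -
  interpret M: Metric_space UNIV "\<lambda>x y. ip_norm ip (x - y)"
    by (rule Metric_space_ip_norm)
  have "M.MCauchy s"
    using assms by (auto simp: M.MCauchy_def)
  then obtain l where "limitin M.mtopology s l sequentially"
    using complete by (auto simp: M.mcomplete_def)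
  then show thesis
    using that by (auto simp: M.limitin_metric_dist_null)
qed

section \<open>Subspaces that are their own complement\<close>

locale hilbert_pair =
  H1: hilbert_space scale1 ip1 + H2: hilbert_space scale2 ip2
  for scale1 :: "'k::real_or_complex \<Rightarrow> 'a::ab_group_add \<Rightarrow> 'a" and ip1
    and scale2 :: "'k \<Rightarrow> 'b::ab_group_add \<Rightarrow> 'b" and ip2
begin

lemma form_eq_0_iff:
  "std_unitary_form ip1 ip2 z w = 0 \<longleftrightarrow> H1.cip (fst z) (fst w) = H2.cip (snd z) (snd w)"
  by (simp add: std_unitary_form_def H1.cip_def H2.cip_def to_complex_eq_iff)

lemma mem_form_complement_iff:
  "(x, y) \<in> form_complement (std_unitary_form ip1 ip2) U \<longleftrightarrow>
    (\<forall>(u, v)\<in>U. H1.cip x u = H2.cip y v)"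
  by (auto simp: form_complement_def form_eq_0_iff)

context
  fixes U
  assumes self: "U = form_complement (std_unitary_form ip1 ip2) U"
begin

lemma mem_self_complement_iff: "(x, y) \<in> U \<longleftrightarrow> (\<forall>(u, v)\<in>U. H1.cip x u = H2.cip y v)"
  by (subst self) (rule mem_form_complement_iff)

lemma cip_eq: "(x, y) \<in> U \<Longrightarrow> (u, v) \<in> U \<Longrightarrow> H1.cip x u = H2.cip y v"
  using mem_self_complement_iff by blast

lemma self_complement_zero: "(0, 0) \<in> U"
  by (auto simp: mem_self_complement_iff)

lemma self_complement_add: "(x, y) \<in> U \<Longrightarrow> (x', y') \<in> U \<Longrightarrow> (x + x', y + y') \<in> U"
  using cip_eq by (subst mem_self_complement_iff) (auto simp: H1.cip_add_left H2.cip_add_left)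

lemma self_complement_diff: "(x, y) \<in> U \<Longrightarrow> (x', y') \<in> U \<Longrightarrow> (x - x', y - y') \<in> U"
  using cip_eq by (subst mem_self_complement_iff) (auto simp: H1.cip_diff_left H2.cip_diff_left)

lemma self_complement_scale: "(x, y) \<in> U \<Longrightarrow> (scale1 c x, scale2 c y) \<in> U"
  using cip_eq by (subst mem_self_complement_iff) (auto simp: H1.cip_scale_left H2.cip_scale_left)

lemma self_complement_sqnorm: "(x, y) \<in> U \<Longrightarrow> H1.sqnorm x = H2.sqnorm y"
  using cip_eq[of x y x y] by (simp add: H1.sqnorm_def H2.sqnorm_def)

lemma self_complement_norm: "(x, y) \<in> U \<Longrightarrow> ip_norm ip1 x = ip_norm ip2 y"
  by (simp add: H1.ip_norm_eq H2.ip_norm_eq self_complement_sqnorm)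

lemma self_complement_unique:
  assumes "(x, y) \<in> U" "(x, y') \<in> U"
  shows "y = y'"
proof -
  have "H2.sqnorm (y - y') = 0"
    using self_complement_sqnorm[OF self_complement_diff[OF assms]] by simp
  then show ?thesis by (simp add: H2.sqnorm_eq_0_iff)
qed

text \<open>Complements are closed, by continuity of the inner products.\<close>
lemma self_complement_closed:
  assumes U: "\<And>n. (s n, t n) \<in> U"
    and s: "(\<lambda>n. ip_norm ip1 (s n - x)) \<longlonglongrightarrow> 0"
    and t: "(\<lambda>n. ip_norm ip2 (t n - y)) \<longlonglongrightarrow> 0"
  shows "(x, y) \<in> U"
proof (subst mem_self_complement_iff, clarify)
  fix u v assume "(u, v) \<in> U"
  then have "(\<lambda>n. H1.cip (s n) u) = (\<lambda>n. H2.cip (t n) v)"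
    using U cip_eq by blast
  then show "H1.cip x u = H2.cip y v"
    using H1.cip_tendsto_left[OF s, of u] H2.cip_tendsto_left[OF t, of v]
    by (simp add: LIMSEQ_unique)
qed

text \<open>
  The projection argument: the distance from \<open>x\<close> to the domain is attained at some \<open>d\<close> in the
  domain, because the partners of a minimising sequence form a Cauchy sequence in the second space
  and the limit of the pairs stays in \<open>U\<close>. Then \<open>x - d\<close> is orthogonal to the domain, so
  \<open>(x - d, 0)\<close> lies in \<open>U\<close>; related vectors have equal norms, hence \<open>x = d\<close>.
\<close>
lemma domain_of_self_complement: "\<exists>y. (x, y) \<in> U"
proof -
  define D where "D = {x. \<exists>y. (x, y) \<in> U}"
  have D: "H1.subspace D"
    unfolding D_def
    by (rule H1.subspaceI)
      (auto intro: self_complement_zero self_complement_add self_complement_scale)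
  obtain s \<delta> where s: "\<And>n::nat. s n \<in> D"
    and lim: "(\<lambda>n. H1.sqnorm (x - s n)) \<longlonglongrightarrow> \<delta>"
    and lower: "\<And>u. u \<in> D \<Longrightarrow> \<delta> \<le> H1.sqnorm (x - u)"
    and Cauchy: "\<And>e. 0 < e \<Longrightarrow> \<exists>N. \<forall>m\<ge>N. \<forall>n\<ge>N. ip_norm ip1 (s m - s n) < e"
    using H1.minimising_Cauchy_sequence[OF D, of x] by blast
  have "\<forall>n. \<exists>t. (s n, t) \<in> U"
    using s by (simp add: D_def)
  from choice[OF this] obtain t where st: "\<And>n. (s n, t n) \<in> U"
    by blast
  have "ip_norm ip1 (s m - s n) = ip_norm ip2 (t m - t n)" for m n
    by (intro self_complement_norm self_complement_diff st)
  then have Cauchy': "\<exists>N. \<forall>m\<ge>N. \<forall>n\<ge>N. ip_norm ip2 (t m - t n) < e" if "0 < e" for e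
    using Cauchy[OF that] by simp
  obtain d where d: "(\<lambda>n. ip_norm ip1 (s n - d)) \<longlonglongrightarrow> 0"
    using H1.Cauchy_sequence_converges[OF Cauchy] by blast
  obtain y where y: "(\<lambda>n. ip_norm ip2 (t n - y)) \<longlonglongrightarrow> 0"
    using H2.Cauchy_sequence_converges[OF Cauchy'] by blast
  have dy: "(d, y) \<in> U"
    using st d y by (rule self_complement_closed)
  have "ip_norm ip1 (x - d) \<le> sqrt \<delta> + 0"
  proof (rule LIMSEQ_le_const[OF tendsto_add])
    show "(\<lambda>n. ip_norm ip1 (x - s n)) \<longlonglongrightarrow> sqrt \<delta>"
      unfolding H1.ip_norm_eq by (rule tendsto_real_sqrt[OF lim])
    have "ip_norm ip1 (x - d) \<le> ip_norm ip1 (x - s n) + ip_norm ip1 (s n - d)" for n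
      using H1.ip_norm_triangle[of "x - s n" "s n - d"] by simp
    then show "\<exists>N. \<forall>n\<ge>N. ip_norm ip1 (x - d) \<le> ip_norm ip1 (x - s n) + ip_norm ip1 (s n - d)"
      by blast
  qed (rule d)
  then have le: "H1.sqnorm (x - d) \<le> \<delta>"
    by (simp add: H1.ip_norm_eq)
  have orth: "H1.cip (x - d) u = 0" if "(u, v) \<in> U" for u v
  proof (rule H1.orthogonal_if_minimal)
    fix c
    have "d + scale1 c u \<in> D"
      using D dy that by (intro H1.subspace_add H1.subspace_scale) (auto simp: D_def)
    from lower[OF this] le show "H1.sqnorm (x - d) \<le> H1.sqnorm (x - d - scale1 c u)"
      by (simp add: diff_diff_eq)
  qed
  have "(x - d, 0) \<in> U"
    by (subst mem_self_complement_iff) (auto intro: orth)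
  then have "x - d = 0"
    using self_complement_sqnorm H1.sqnorm_eq_0_iff by fastforce
  with dy show ?thesis by auto
qed

end

text \<open>The domain statement for the flipped relation, whose form is the negative of the given one.\<close>
lemma range_of_self_complement:
  assumes self: "U = form_complement (std_unitary_form ip1 ip2) U"
  shows "\<exists>x. (x, y) \<in> U"
proof -
  interpret swapped: hilbert_pair scale2 ip2 scale1 ip1 ..
  have "prod.swap ` U = form_complement (std_unitary_form ip2 ip1) (prod.swap ` U)"
  proof (rule set_eqI, clarify)
    fix b a
    have "(b, a) \<in> prod.swap ` U \<longleftrightarrow> (a, b) \<in> U"
      by (force simp: image_iff)
    also have "\<dots> \<longleftrightarrow> (b, a) \<in> form_complement (std_unitary_form ip2 ip1) (prod.swap ` U)"
      by (force simp: mem_self_complement_iff[OF self, of a b] swapped.mem_form_complement_iff)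
    finally show "(b, a) \<in> prod.swap ` U \<longleftrightarrow>
      (b, a) \<in> form_complement (std_unitary_form ip2 ip1) (prod.swap ` U)" .
  qed
  from swapped.domain_of_self_complement[OF this, of y] show ?thesis by auto
qed

lemma unitary_of_self_complement:
  assumes self: "U = form_complement (std_unitary_form ip1 ip2) U"
  shows "\<exists>L. unitary_operator scale1 ip1 scale2 ip2 L \<and> U = op_graph L"
proof -
  obtain L where L: "\<And>x. (x, L x) \<in> U"
    using domain_of_self_complement[OF self] by metis
  have graph: "y = L x" if "(x, y) \<in> U" for x y
    using self_complement_unique[OF self that L] .
  have "Vector_Spaces.linear scale1 scale2 L"
    by (intro Vector_Spaces.linear_iff[THEN iffD2] conjI allI H1.vector_space_axioms H2.vector_space_axioms)
      (auto intro!: graph[symmetric] L self_complement_add[OF self] self_complement_scale[OF self])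
  moreover have "surj L"
    using range_of_self_complement[OF self] graph by (metis surjI surj_def)
  moreover have "ip2 (L x) (L y) = ip1 x y" for x y
    using cip_eq[OF self L L, of x y] by (simp add: H1.cip_def H2.cip_def to_complex_eq_iff)
  moreover have "U = op_graph L"
    using L graph by (auto simp: op_graph_def)
  ultimately show ?thesis unfolding unitary_operator_def by blast
qed

text \<open>
  For an isometry, \<open>(x, y)\<close> is orthogonal to the graph exactly if \<open>L x - y\<close> is orthogonal to the range;
  surjectivity turns this into \<open>L x = y\<close>.
\<close>
lemma self_complement_of_unitary:
  assumes L: "unitary_operator scale1 ip1 scale2 ip2 L"
  shows "op_graph L = form_complement (std_unitary_form ip1 ip2) (op_graph L)"
proof (rule set_eqI, clarify)
  fix x y
  have isometric: "H1.cip u v = H2.cip (L u) (L v)" for u v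
    using L by (simp add: unitary_operator_def H1.cip_def H2.cip_def)
  have "(x, y) \<in> form_complement (std_unitary_form ip1 ip2) (op_graph L) \<longleftrightarrow>
      (\<forall>u. H2.cip (L x - y) (L u) = 0)"
    by (auto simp: mem_form_complement_iff op_graph_def isometric H2.cip_diff_left)
  also have "\<dots> \<longleftrightarrow> (\<forall>v. H2.cip (L x - y) v = 0)"
    using L by (metis unitary_operator_def surjD)
  also have "\<dots> \<longleftrightarrow> L x - y = 0"
    using H2.sqnorm_eq_0_iff[of "L x - y"] by (auto simp: H2.sqnorm_def)
  finally show "(x, y) \<in> op_graph L \<longleftrightarrow>
      (x, y) \<in> form_complement (std_unitary_form ip1 ip2) (op_graph L)"
    by (auto simp: op_graph_def)
qed

end

theorem proposition1p8:
  fixes scale1 :: "'k::real_or_complex \<Rightarrow> 'a::ab_group_add \<Rightarrow> 'a"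
    and ip1 :: "'a \<Rightarrow> 'a \<Rightarrow> 'k"
    and scale2 :: "'k \<Rightarrow> 'b::ab_group_add \<Rightarrow> 'b"
    and ip2 :: "'b \<Rightarrow> 'b \<Rightarrow> 'k"
    and U :: "('a \<times> 'b) set"
  assumes "hilbert_space scale1 ip1"
    and "hilbert_space scale2 ip2"
    and "module.subspace (module_prod.scale scale1 scale2) U"
  shows "(\<exists>L. unitary_operator scale1 ip1 scale2 ip2 L \<and> U = op_graph L) \<longleftrightarrow>
    U = form_complement (std_unitary_form ip1 ip2) U"
proof -
  interpret hilbert_pair scale1 ip1 scale2 ip2
    using assms(1,2) by (rule hilbert_pair.intro)
  show ?thesis
    using self_complement_of_unitary unitary_of_self_complement by blast
qed

end
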